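(* If $T$ is a weighted tree, then its subdivision $S(T)$ does not admit $\epsilon$-uniform mixing relative to its (weighted) adjacency matrix.
   Context: The subdivision $S(X)$ of a graph $X$ is obtained from $X$ by replacing each edge $\{u,v\}$ of $X$ by two edges $\{u,w\}$ and $\{w,v\}$, where $w$ is a new vertex (one new vertex for each edge). The edges of $S(T)$ may carry any assignment of positive weights. For a weighted graph on $N$ vertices with weighted adjacency matrix $A$, put $U(t)=e^{\mathrm{i}tA}$; $\mathbf{e}_u$ is the characteristic vector of $u$, $\mathbf{1}$ the all-ones vector, $\circ$ the entrywise product. $\epsilon$-uniform mixing occurs if for each $\epsilon>0$ there is a $\tau\in\mathbb{R}$ such that $\big\|(U(\tau)\mathbf{e}_u)\circ(\overline{U(\tau)}\mathbf{e}_u)-\tfrac1N\mathbf{1}\big\|<\epsilon$ simultaneously for all vertices $u$.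
   Formalization: The tree T is assumed to have at least two vertices, because for the one-vertex tree the subdivision is a single vertex with zero adjacency matrix and uniform mixing holds trivially. *)

theory Defs
  imports "HOL-Analysis.Analysis"
begin

section \<open>Graphs, trees and subdivisions\<close>

definition simple_graph :: "'a set \<Rightarrow> 'a set set \<Rightarrow> bool" where
  "simple_graph V E \<longleftrightarrow> finite V \<and> (\<forall>e\<in>E. \<exists>u\<in>V. \<exists>v\<in>V. u \<noteq> v \<and> e = {u, v})"

definition weighted_graph :: "'a set \<Rightarrow> 'a set set \<Rightarrow> ('a set \<Rightarrow> real) \<Rightarrow> bool" where
  "weighted_graph V E w \<longleftrightarrow> simple_graph V E \<and> (\<forall>e\<in>E. w e > 0)"

definition graph_walk :: "'a set \<Rightarrow> 'a set set \<Rightarrow> 'a list \<Rightarrow> bool" where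
  "graph_walk V E p \<longleftrightarrow> p \<noteq> [] \<and> set p \<subseteq> V \<and> successively (\<lambda>u v. {u, v} \<in> E) p"

definition graph_connected :: "'a set \<Rightarrow> 'a set set \<Rightarrow> bool" where
  "graph_connected V E \<longleftrightarrow>
     V \<noteq> {} \<and> (\<forall>u\<in>V. \<forall>v\<in>V. \<exists>p. graph_walk V E p \<and> hd p = u \<and> last p = v)"

text \<open>A cycle is given by the list of its distinct vertices; the first vertex is not repeated
  at the end.\<close>

definition graph_cycle :: "'a set \<Rightarrow> 'a set set \<Rightarrow> 'a list \<Rightarrow> bool" where
  "graph_cycle V E p \<longleftrightarrow>
     graph_walk V E p \<and> distinct p \<and> 3 \<le> length p \<and> {last p, hd p} \<in> E"

definition graph_tree :: "'a set \<Rightarrow> 'a set set \<Rightarrow> bool" where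
  "graph_tree V E \<longleftrightarrow> simple_graph V E \<and> graph_connected V E \<and> (\<nexists>p. graph_cycle V E p)"

text \<open>The new vertex placed on the edge \<open>e\<close> is \<open>Inr e\<close>; an old vertex \<open>u\<close> becomes \<open>Inl u\<close>.\<close>

definition subdiv_verts :: "'a set \<Rightarrow> 'a set set \<Rightarrow> ('a + 'a set) set" where
  "subdiv_verts V E = Inl ` V \<union> Inr ` E"

definition subdiv_edges :: "'a set set \<Rightarrow> ('a + 'a set) set set" where
  "subdiv_edges E = {{Inl u, Inr e} | u e. e \<in> E \<and> u \<in> e}"

lemma simple_graph_subdivision:
  assumes "simple_graph V E"
  shows "simple_graph (subdiv_verts V E) (subdiv_edges E)"
proof -
  have "E \<subseteq> Pow V" "finite V"
    using assms by (auto simp: simple_graph_def)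
  then have "finite (subdiv_verts V E)"
    by (auto simp: subdiv_verts_def intro: finite_subset)
  moreover have "\<exists>x\<in>subdiv_verts V E. \<exists>y\<in>subdiv_verts V E. x \<noteq> y \<and> f = {x, y}"
    if "f \<in> subdiv_edges E" for f
  proof -
    from that obtain u e where "e \<in> E" "u \<in> e" and f: "f = {Inl u, Inr e}"
      by (auto simp: subdiv_edges_def)
    with \<open>E \<subseteq> Pow V\<close> have "Inl u \<in> subdiv_verts V E" "Inr e \<in> subdiv_verts V E"
      by (auto simp: subdiv_verts_def)
    with f show ?thesis by blast
  qed
  ultimately show ?thesis
    by (auto simp: simple_graph_def)
qed

section \<open>Matrices indexed by a finite set\<close>

text \<open>A matrix with rows and columns indexed by a finite set \<open>V\<close> is a function of type
  \<open>'a \<Rightarrow> 'a \<Rightarrow> complex\<close> of which only the values on \<open>V \<times> V\<close> matter.\<close>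

primrec mat_pow_on :: "'a set \<Rightarrow> ('a \<Rightarrow> 'a \<Rightarrow> complex) \<Rightarrow> nat \<Rightarrow> 'a \<Rightarrow> 'a \<Rightarrow> complex" where
  "mat_pow_on V M 0 = (\<lambda>u v. if u = v then 1 else 0)"
| "mat_pow_on V M (Suc k) = (\<lambda>u v. \<Sum>x\<in>V. M u x * mat_pow_on V M k x v)"

definition mat_exp_on :: "'a set \<Rightarrow> ('a \<Rightarrow> 'a \<Rightarrow> complex) \<Rightarrow> 'a \<Rightarrow> 'a \<Rightarrow> complex" where
  "mat_exp_on V M u v = (\<Sum>k. mat_pow_on V M k u v / fact k)"

definition mat_vec_on :: "'a set \<Rightarrow> ('a \<Rightarrow> 'a \<Rightarrow> complex) \<Rightarrow> ('a \<Rightarrow> complex) \<Rightarrow> 'a \<Rightarrow> complex" where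
  "mat_vec_on V M x u = (\<Sum>v\<in>V. M u v * x v)"

definition char_vec :: "'a \<Rightarrow> 'a \<Rightarrow> complex" where
  "char_vec u v = (if v = u then 1 else 0)"

lemma norm_mat_pow_on_le:
  assumes "finite V" "u \<in> V" and bound: "\<And>x y. x \<in> V \<Longrightarrow> y \<in> V \<Longrightarrow> norm (M x y) \<le> c"
    and "v \<in> V" "0 \<le> c"
  shows "norm (mat_pow_on V M k u v) \<le> (real (card V) * c) ^ k"
  using \<open>u \<in> V\<close>
proof (induction k arbitrary: u)
  case 0
  then show ?case by simp
next
  case (Suc k)
  have "norm (mat_pow_on V M (Suc k) u v) \<le> (\<Sum>x\<in>V. norm (M u x * mat_pow_on V M k x v))"
    by (simp add: sum_norm_le)
  also have "\<dots> \<le> (\<Sum>x\<in>V. c * (real (card V) * c) ^ k)"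
    using Suc bound \<open>0 \<le> c\<close> by (intro sum_mono) (auto simp: norm_mult intro!: mult_mono)
  finally show ?case by (simp add: mult_ac)
qed

lemma summable_mat_exp_on:
  assumes "finite V" "u \<in> V" "v \<in> V"
  shows "summable (\<lambda>k. mat_pow_on V M k u v / fact k)"
proof -
  define c where "c = (\<Sum>x\<in>V. \<Sum>y\<in>V. norm (M x y))"
  have "norm (M x y) \<le> c" if "x \<in> V" "y \<in> V" for x y
  proof -
    have "norm (M x y) \<le> (\<Sum>y\<in>V. norm (M x y))"
      using that assms by (intro member_le_sum) auto
    also have "\<dots> \<le> c"
      unfolding c_def using that assms
      by (intro member_le_sum[of x V "\<lambda>x. \<Sum>y\<in>V. norm (M x y)"]) (auto intro: sum_nonneg)
    finally show ?thesis .
  qed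
  moreover have "0 \<le> c" by (simp add: c_def sum_nonneg)
  ultimately have le: "norm (mat_pow_on V M k u v) \<le> (real (card V) * c) ^ k" for k
    using assms by (intro norm_mat_pow_on_le) auto
  have "summable (\<lambda>k. inverse (fact k) * (real (card V) * c) ^ k)"
    by (rule summable_exp)
  then show ?thesis
  proof (rule summable_comparison_test'[where N = 0])
    fix k
    show "norm (mat_pow_on V M k u v / fact k) \<le> inverse (fact k) * (real (card V) * c) ^ k"
      using le[of k] by (simp add: norm_divide field_simps)
  qed
qed

section \<open>Continuous quantum walks\<close>

definition adjacency_matrix :: "'a set set \<Rightarrow> ('a set \<Rightarrow> real) \<Rightarrow> 'a \<Rightarrow> 'a \<Rightarrow> complex" where
  "adjacency_matrix E w u v = (if {u, v} \<in> E then complex_of_real (w {u, v}) else 0)"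

definition transition_matrix ::
  "'a set \<Rightarrow> ('a \<Rightarrow> 'a \<Rightarrow> complex) \<Rightarrow> real \<Rightarrow> 'a \<Rightarrow> 'a \<Rightarrow> complex" where
  "transition_matrix V A t = mat_exp_on V (\<lambda>u v. \<i> * complex_of_real t * A u v)"

definition eps_uniform_mixing :: "'a set \<Rightarrow> ('a \<Rightarrow> 'a \<Rightarrow> complex) \<Rightarrow> bool" where
  "eps_uniform_mixing V A \<longleftrightarrow>
     (\<forall>\<epsilon>::real. \<epsilon> > 0 \<longrightarrow>
       (\<exists>\<tau>::real. \<forall>u\<in>V.
          L2_set (\<lambda>v. norm
            (mat_vec_on V (transition_matrix V A \<tau>) (char_vec u) v
             * mat_vec_on V (\<lambda>x y. cnj (transition_matrix V A \<tau> x y)) (char_vec u) v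
             - 1 / of_nat (card V))) V < \<epsilon>))"

end

theory Submission
  imports Defs
begin

text \<open>A tree has one edge fewer than vertices, so \<open>S(T)\<close> has an odd number \<open>N\<close> of vertices, and it
  is bipartite. Hence the entries of \<open>U(t)\<close> are real inside the colour classes and purely imaginary
  between them. For two distinct vertices of the same class the columns of \<open>U(t)\<close> are orthogonal,
  and every term of their inner product is real. Near uniform mixing each of these \<open>N\<close> terms is close
  to \<open>1/N\<close> or \<open>-1/N\<close>, and an odd number of such terms cannot sum to zero.\<close>

section \<open>The number of edges of a tree\<close>

text \<open>Grow a set \<open>W\<close> in which any two vertices are joined by a path, one vertex at a time:
  a new vertex with two neighbours in \<open>W\<close> would close a cycle.\<close>

lemma path_connected_subset_of_card:
  assumes tree: "graph_tree V E" and "1 \<le> k" "k \<le> card V"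
  shows "\<exists>W\<subseteq>V. card W = k \<and> Suc (card {e\<in>E. e \<subseteq> W}) = k \<and>
    (\<forall>u\<in>W. \<forall>v\<in>W. \<exists>p. graph_walk W E p \<and> distinct p \<and> hd p = u \<and> last p = v)"
  using assms(2,3)
proof (induction k rule: dec_induct)
  case base
  from tree obtain r where r: "r \<in> V"
    by (auto simp: graph_tree_def graph_connected_def)
  have "{e\<in>E. e \<subseteq> {r}} = {}"
    using tree by (fastforce simp: graph_tree_def simple_graph_def)
  moreover have "graph_walk {r} E [r] \<and> distinct [r] \<and> hd [r] = r \<and> last [r] = r"
    by (simp add: graph_walk_def)
  ultimately show ?case
    using r by (intro exI[of _ "{r}"]) (auto simp del: distinct.simps)
next
  case (step k)
  then obtain W where W: "W \<subseteq> V" "card W = k" "Suc (card {e\<in>E. e \<subseteq> W}) = k"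
    and path: "\<And>u v. u \<in> W \<Longrightarrow> v \<in> W \<Longrightarrow>
      \<exists>p. graph_walk W E p \<and> distinct p \<and> hd p = u \<and> last p = v"
    by auto
  have fin: "finite V" and EV: "\<And>e. e \<in> E \<Longrightarrow> \<exists>u\<in>V. \<exists>v\<in>V. u \<noteq> v \<and> e = {u, v}"
    using tree by (auto simp: graph_tree_def simple_graph_def)
  have finW: "finite W" using W fin finite_subset by blast
  have "W \<noteq> {}" using W step by auto
  then obtain r where r: "r \<in> W" by blast
  have "W \<noteq> V" using W step by auto
  then obtain s where s: "s \<in> V" "s \<notin> W" using W by blast
  obtain q where q: "graph_walk V E q" "hd q = r" "last q = s"
    using tree r s W by (auto simp: graph_tree_def graph_connected_def) blast
  \<comment> \<open>A walk from \<open>r\<close> in \<open>W\<close> to \<open>s\<close> outside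
    must leave \<open>W\<close>: the induction moves the start along the walk for as long as it
    stays in \<open>W\<close>.\<close>
  have "\<exists>a\<in>W. \<exists>b\<in>V - W. {a, b} \<in> E"
    using q r s(2)
  proof (induction q arbitrary: r)
    case Nil
    then show ?case by (simp add: graph_walk_def)
  next
    case (Cons x q)
    show ?case
    proof (cases q)
      case Nil
      then show ?thesis using Cons.prems by auto
    next
      case (Cons y q')
      then have xy: "{x, y} \<in> E" "y \<in> V" "x \<in> W" "graph_walk V E q"
        using Cons.prems by (auto simp: graph_walk_def)
      show ?thesis
      proof (cases "y \<in> W")
        case True
        show ?thesis
          by (rule Cons.IH[OF xy(4) _ _ True]) (use Cons Cons.prems in auto)
      next
        case False
        then show ?thesis using xy by blast
      qed
    qed
  qed
  then obtain a b where ab: "a \<in> W" "b \<in> V" "b \<notin> W" "{a, b} \<in> E" by blast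
  \<comment> \<open>With a second neighbour \<open>c\<close> of \<open>b\<close>, a path from
    \<open>a\<close> to \<open>c\<close> inside \<open>W\<close> followed by \<open>b\<close> is a
    cycle; it has at least three vertices because \<open>a\<close> and \<open>c\<close>
    differ.\<close>
  have unique: "c = a" if c: "c \<in> W" "{c, b} \<in> E" for c
  proof (rule ccontr)
    assume "c \<noteq> a"
    obtain p where p: "graph_walk W E p" "distinct p" "hd p = a" "last p = c"
      using path ab c by blast
    have "p \<noteq> []" "set p \<subseteq> W" using p by (auto simp: graph_walk_def)
    have "2 \<le> length p"
      using \<open>c \<noteq> a\<close> \<open>p \<noteq> []\<close> p(3,4) by (cases p rule: remdups_adj.cases) auto
    then have "graph_cycle V E (p @ [b])"
      using p ab(2-4) c(2) \<open>p \<noteq> []\<close> \<open>set p \<subseteq> W\<close> W(1) insert_commute[of a b "{}"]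
      by (auto simp: graph_cycle_def graph_walk_def successively_append_iff)
    then show False using tree by (auto simp: graph_tree_def)
  qed
  \<comment> \<open>An edge through \<open>b\<close> has its other end in \<open>W\<close>, and
    \<open>unique\<close> makes that end \<open>a\<close>. Vertices and edges thus both increase by
    one.\<close>
  have new_edges: "{e\<in>E. e \<subseteq> insert b W} = insert {a, b} {e\<in>E. e \<subseteq> W}"
  proof (intro equalityI subsetI)
    fix e assume e: "e \<in> {e\<in>E. e \<subseteq> insert b W}"
    then have "e \<in> E" by simp
    from EV[OF this] obtain x y where xy: "x \<noteq> y" "e = {x, y}" by auto
    show "e \<in> insert {a, b} {e\<in>E. e \<subseteq> W}"
    proof (cases "b \<in> e")
      case True
      then obtain c where "c \<noteq> b" "e = {c, b}" using xy by (metis doubleton_eq_iff insertE singletonD)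
      then show ?thesis using e unique by auto
    next
      case False
      then show ?thesis using e by blast
    qed
  next
    fix e assume "e \<in> insert {a, b} {e\<in>E. e \<subseteq> W}"
    then show "e \<in> {e\<in>E. e \<subseteq> insert b W}" using ab by blast
  qed
  have "finite {e\<in>E. e \<subseteq> W}"
    using finW finite_subset[of "{e\<in>E. e \<subseteq> W}" "Pow W"] by blast
  then have card_edges: "Suc (card {e\<in>E. e \<subseteq> insert b W}) = Suc k"
    unfolding new_edges using W ab by (subst card_insert_disjoint) auto
  \<comment> \<open>Paths to the new vertex go through \<open>a\<close>; they stay free of
    repetitions because \<open>b\<close> is not in \<open>W\<close>. Reversal gives
    \<open>from_b\<close>.\<close>
  have to_b: "\<exists>p. graph_walk (insert b W) E p \<and> distinct p \<and> hd p = u \<and> last p = b"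
    if u: "u \<in> W" for u
  proof -
    obtain p where p: "graph_walk W E p" "distinct p" "hd p = u" "last p = a"
      using path ab u by blast
    then have "graph_walk (insert b W) E (p @ [b]) \<and> distinct (p @ [b]) \<and>
        hd (p @ [b]) = u \<and> last (p @ [b]) = b"
      using ab by (auto simp: graph_walk_def successively_append_iff)
    then show ?thesis by blast
  qed
  have from_b: "\<exists>p. graph_walk (insert b W) E p \<and> distinct p \<and> hd p = b \<and> last p = u"
    if u: "u \<in> W" for u
  proof -
    obtain p where p: "graph_walk (insert b W) E p" "distinct p" "hd p = u" "last p = b"
      using to_b u by blast
    then have "graph_walk (insert b W) E (rev p) \<and> distinct (rev p) \<and>
        hd (rev p) = b \<and> last (rev p) = u"
      by (auto simp: graph_walk_def hd_rev last_rev insert_commute)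
    then show ?thesis by blast
  qed
  have b_b: "\<exists>p. graph_walk (insert b W) E p \<and> distinct p \<and> hd p = b \<and> last p = b"
    by (intro exI[of _ "[b]"]) (simp add: graph_walk_def)
  have within: "\<exists>p. graph_walk (insert b W) E p \<and> distinct p \<and> hd p = u \<and> last p = v"
    if "u \<in> W" "v \<in> W" for u v
    using path[OF that] by (auto simp: graph_walk_def)
  have "insert b W \<subseteq> V \<and> card (insert b W) = Suc k"
    using W ab finW by auto
  then show ?case
    using card_edges to_b from_b b_b within by (intro exI[of _ "insert b W"]) auto
qed

lemma card_edges_graph_tree:
  assumes "graph_tree V E"
  shows "Suc (card E) = card V"
proof -
  have fin: "finite V" "V \<noteq> {}" and E: "\<And>e. e \<in> E \<Longrightarrow> e \<subseteq> V"
    using assms by (auto simp: graph_tree_def graph_connected_def simple_graph_def)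
  then have "1 \<le> card V" by (simp add: Suc_le_eq card_gt_0_iff)
  then obtain W where W: "W \<subseteq> V" "card W = card V" "Suc (card {e\<in>E. e \<subseteq> W}) = card V"
    using path_connected_subset_of_card[OF assms] by blast
  then have "W = V" using fin card_subset_eq by blast
  moreover have "{e\<in>E. e \<subseteq> V} = E" using E by blast
  ultimately show ?thesis using W by simp
qed

text \<open>With n old vertices there are n - 1 new ones, hence 2n - 1 in all.\<close>

lemma odd_card_subdiv_verts:
  assumes "graph_tree V E"
  shows "odd (card (subdiv_verts V E))"
proof -
  have "finite V" "E \<subseteq> Pow V"
    using assms by (auto simp: graph_tree_def simple_graph_def)
  then have "finite E" "finite V" by (auto intro: finite_subset)
  then have "card (subdiv_verts V E) = card V + card E"
    unfolding subdiv_verts_def by (subst card_Un_disjoint) (auto simp: card_image)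
  then show ?thesis using card_edges_graph_tree[OF assms, symmetric] by simp
qed

section \<open>Powers and exponentials of matrices indexed by a finite set\<close>

lemma mat_pow_on_uminus:
  "mat_pow_on V (\<lambda>x y. - M x y) k u v = (-1) ^ k * mat_pow_on V M k u v"
  by (induction k arbitrary: u) (simp_all add: sum_distrib_left mult_ac flip: sum_negf)

lemma cnj_mat_pow_on:
  "cnj (mat_pow_on V M k u v) = mat_pow_on V (\<lambda>x y. cnj (M x y)) k u v"
  by (induction k arbitrary: u) simp_all

lemma mat_pow_on_add:
  assumes "finite V" "u \<in> V"
  shows "mat_pow_on V M (j + k) u v = (\<Sum>x\<in>V. mat_pow_on V M j u x * mat_pow_on V M k x v)"
  using assms(2)
proof (induction j arbitrary: u)
  case 0
  then show ?case using assms(1) by (simp add: if_distrib[of "\<lambda>c. c * _"] cong: if_cong)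
next
  case (Suc j)
  have "mat_pow_on V M (Suc j + k) u v =
      (\<Sum>y\<in>V. \<Sum>x\<in>V. M u y * (mat_pow_on V M j y x * mat_pow_on V M k x v))"
    by (simp add: Suc.IH sum_distrib_left)
  also have "\<dots> = (\<Sum>x\<in>V. \<Sum>y\<in>V. M u y * (mat_pow_on V M j y x * mat_pow_on V M k x v))"
    by (rule sum.swap)
  finally show ?case by (simp add: sum_distrib_right mult.assoc)
qed

lemma mat_pow_on_sym:
  assumes "finite V" "u \<in> V" "v \<in> V" and sym: "\<And>x y. x \<in> V \<Longrightarrow> y \<in> V \<Longrightarrow> M x y = M y x"
  shows "mat_pow_on V M k u v = mat_pow_on V M k v u"
  using assms(2,3)
proof (induction k arbitrary: u v)
  case (Suc k)
  have one: "mat_pow_on V M 1 x y = M x y" if "y \<in> V" for x y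
    using that assms(1) by (simp add: if_distrib[of "\<lambda>c. _ * c"] cong: if_cong)
  \<comment> \<open>The recursion splits off the first factor; the transposed product needs the last
    one split off, which is \<open>mat_pow_on_add\<close> with exponents \<open>k\<close> and
    \<open>1\<close>.\<close>
  have "mat_pow_on V M (Suc k) v u = (\<Sum>x\<in>V. mat_pow_on V M k v x * M x u)"
    using mat_pow_on_add[OF assms(1) Suc.prems(2), of M k 1 u] one[OF Suc.prems(1)] by simp
  also have "\<dots> = (\<Sum>x\<in>V. M u x * mat_pow_on V M k x v)"
    using Suc sym by (intro sum.cong) (auto simp: mult.commute)
  finally show ?case by simp
qed auto

text \<open>A nonzero entry of the \<open>k\<close>-th power comes from a walk of length
  \<open>k\<close>, and each of its steps changes the colour.\<close>

lemma mat_pow_on_bipartite: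
  assumes bip: "\<And>x y. x \<in> V \<Longrightarrow> y \<in> V \<Longrightarrow> M x y \<noteq> 0 \<Longrightarrow> c x \<noteq> (c y :: bool)"
    and "u \<in> V" "mat_pow_on V M k u v \<noteq> 0"
  shows "even k \<longleftrightarrow> c u = c v"
  using assms(2,3)
proof (induction k arbitrary: u)
  case 0
  then show ?case by (auto split: if_splits)
next
  case (Suc k)
  then obtain x where x: "x \<in> V" "M u x * mat_pow_on V M k x v \<noteq> 0"
    by (auto elim: sum.not_neutral_contains_not_neutral)
  then have "c u \<noteq> c x" "even k \<longleftrightarrow> c x = c v"
    using bip Suc by auto
  then show ?case by auto
qed

text \<open>Absolute convergence is what the Cauchy product of two exponential series
  requires.\<close>

lemma summable_norm_mat_exp_on:
  assumes "finite V" "u \<in> V" "v \<in> V"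
  shows "summable (\<lambda>k. norm (mat_pow_on V M k u v / fact k))"
proof -
  define c where "c = (\<Sum>(x, y)\<in>V \<times> V. norm (M x y))"
  have "norm (M x y) \<le> c" if "x \<in> V" "y \<in> V" for x y
    unfolding c_def using that assms
      member_le_sum[of "(x, y)" "V \<times> V" "\<lambda>(x, y). norm (M x y)"] by auto
  moreover have "0 \<le> c" by (auto simp: c_def intro: sum_nonneg)
  ultimately have le: "norm (mat_pow_on V M k u v) \<le> (real (card V) * c) ^ k" for k
    using assms by (intro norm_mat_pow_on_le) auto
  have "summable (\<lambda>k. inverse (fact k) * (real (card V) * c) ^ k)"
    by (rule summable_exp)
  then show ?thesis
  proof (rule summable_comparison_test'[where N = 0])
    fix k
    show "norm (norm (mat_pow_on V M k u v / fact k)) \<le> inverse (fact k) * (real (card V) * c) ^ k"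
      using le[of k] by (simp add: norm_divide field_simps)
  qed
qed

text \<open>In the Cauchy product of exp(-M) and exp(M) the term of degree k is (-1 + 1)^k M^k / k!,
  so only the identity matrix at k = 0 survives. For \<open>M = i t A\<close> this yields the
  orthogonality of the columns of U(t).\<close>

lemma mat_exp_on_uminus_mult:
  assumes V: "finite V" and u: "u \<in> V" and v: "v \<in> V"
  shows "(\<Sum>x\<in>V. mat_exp_on V (\<lambda>x y. - M x y) u x * mat_exp_on V M x v) = (if u = v then 1 else 0)"
proof -
  let ?P = "mat_pow_on V M" and ?Q = "mat_pow_on V (\<lambda>x y. - M x y)"
  have coeff: "(\<Sum>x\<in>V. \<Sum>i\<le>k. ?Q i u x / fact i * (?P (k - i) x v / fact (k - i))) =
      (if k = 0 then (if u = v then 1 else 0) else 0)" for k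
  proof -
    have "(\<Sum>x\<in>V. \<Sum>i\<le>k. ?Q i u x / fact i * (?P (k - i) x v / fact (k - i))) =
        (\<Sum>i\<le>k. \<Sum>x\<in>V. (-1) ^ i * (?P i u x * ?P (k - i) x v) / (fact i * fact (k - i)))"
      by (subst sum.swap) (simp add: mat_pow_on_uminus mult.assoc)
    also have "\<dots> = (\<Sum>i\<le>k. (-1) ^ i / (fact i * fact (k - i)) * ?P k u v)"
    proof (rule sum.cong[OF refl])
      fix i assume "i \<in> {..k}"
      then have "?P k u v = (\<Sum>x\<in>V. ?P i u x * ?P (k - i) x v)"
        using mat_pow_on_add[OF V u, of M i "k - i" v] by simp
      then show "(\<Sum>x\<in>V. (-1) ^ i * (?P i u x * ?P (k - i) x v) / (fact i * fact (k - i))) =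
          (-1) ^ i / (fact i * fact (k - i)) * ?P k u v"
        by (simp add: sum_distrib_left sum_divide_distrib)
    qed
    \<comment> \<open>Multiplying and dividing by \<open>fact k\<close> turns the factorials into
      binomial coefficients; the factor \<open>1 ^ (k - i)\<close> gives the shape of the binomial
      theorem.\<close>
    also have "\<dots> = (\<Sum>i\<le>k. of_nat (k choose i) * (-1) ^ i * 1 ^ (k - i)) * (?P k u v / fact k)"
      unfolding sum_distrib_right by (intro sum.cong) (simp_all add: binomial_fact)
    also have "\<dots> = (-1 + 1) ^ k * (?P k u v / fact k)"
      by (subst binomial_ring) simp
    finally show ?thesis by (cases k) auto
  qed
  have "(\<lambda>k. \<Sum>x\<in>V. \<Sum>i\<le>k. ?Q i u x / fact i * (?P (k - i) x v / fact (k - i)))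
      sums (\<Sum>x\<in>V. mat_exp_on V (\<lambda>x y. - M x y) u x * mat_exp_on V M x v)"
    unfolding mat_exp_on_def
    by (intro sums_sum Cauchy_product_sums summable_norm_mat_exp_on V u v)
  moreover have "(\<lambda>k. if k = 0 then (if u = v then 1 else 0) else (0 :: complex))
      sums (if u = v then 1 else 0)"
    by (rule sums_single)
  ultimately show ?thesis
    unfolding coeff by (rule sums_unique2)
qed

lemma cnj_mat_exp_on:
  assumes "finite V" "u \<in> V" "v \<in> V"
  shows "cnj (mat_exp_on V M u v) = mat_exp_on V (\<lambda>x y. cnj (M x y)) u v"
proof -
  have "(\<lambda>k. mat_pow_on V M k u v / fact k) sums mat_exp_on V M u v"
    unfolding mat_exp_on_def by (rule summable_sums[OF summable_mat_exp_on[OF assms]])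
  then have "(\<lambda>k. cnj (mat_pow_on V M k u v / fact k)) sums cnj (mat_exp_on V M u v)"
    by (simp only: sums_cnj)
  then show ?thesis
    by (simp add: cnj_mat_pow_on mat_exp_on_def sums_unique)
qed

lemma mat_exp_on_sym:
  assumes "finite V" "u \<in> V" "v \<in> V" "\<And>x y. x \<in> V \<Longrightarrow> y \<in> V \<Longrightarrow> M x y = M y x"
  shows "mat_exp_on V M u v = mat_exp_on V M v u"
  unfolding mat_exp_on_def using mat_pow_on_sym[OF assms] by simp

text \<open>Only even powers contribute to an entry inside a colour class and only odd powers to one
  between classes, so negating \<open>M\<close> changes all terms of the series by the same
  sign.\<close>

lemma mat_exp_on_uminus_bipartite:
  assumes "finite V" "u \<in> V" "v \<in> V"
    and bip: "\<And>x y. x \<in> V \<Longrightarrow> y \<in> V \<Longrightarrow> M x y \<noteq> 0 \<Longrightarrow> c x \<noteq> (c y :: bool)"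
  shows "mat_exp_on V (\<lambda>x y. - M x y) u v = (if c u = c v then 1 else -1) * mat_exp_on V M u v"
proof -
  have eq: "mat_pow_on V (\<lambda>x y. - M x y) k u v =
      (if c u = c v then 1 else -1) * mat_pow_on V M k u v" for k
    using mat_pow_on_bipartite[of V M c u k v] bip assms(2)
    by (cases "mat_pow_on V M k u v = 0") (auto simp: mat_pow_on_uminus)
  show ?thesis
    unfolding mat_exp_on_def eq
    using suminf_mult[OF summable_mat_exp_on[OF assms(1-3)], of "if c u = c v then 1 else -1" M]
    by simp
qed

section \<open>Bipartite graphs of odd order\<close>

lemma odd_sum_of_odd:
  fixes s :: "'b \<Rightarrow> int"
  assumes "finite V" "odd (card V)" "\<And>v. v \<in> V \<Longrightarrow> odd (s v)"
  shows "odd (\<Sum>v\<in>V. s v)"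
  using assms by (simp add: even_sum_iff) (metis (mono_tags, lifting) Collect_cong Collect_mem_eq)

text \<open>Replace each \<open>z v\<close> by its sign: the signs have an odd sum, of absolute
  value at least 1, while the total replacement error is below 1.\<close>

lemma odd_sum_near_sign_neq_0:
  fixes z :: "'b \<Rightarrow> real"
  assumes fin: "finite V" and odd: "odd (card V)"
    and near: "\<And>v. v \<in> V \<Longrightarrow> \<bar>\<bar>z v\<bar> - 1\<bar> < 1 / card V"
  shows "(\<Sum>v\<in>V. z v) \<noteq> 0"
proof
  assume zero: "(\<Sum>v\<in>V. z v) = 0"
  define s :: "'b \<Rightarrow> int" where "s v = (if z v \<ge> 0 then 1 else -1)" for v
  have ne: "V \<noteq> {}" using odd by auto
  have "odd (\<Sum>v\<in>V. s v)"
    using fin odd by (rule odd_sum_of_odd) (auto simp: s_def)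
  then have "1 \<le> \<bar>\<Sum>v\<in>V. s v\<bar>"
    by (cases "(\<Sum>v\<in>V. s v) = 0") auto
  then have "1 \<le> \<bar>\<Sum>v\<in>V. z v - of_int (s v)\<bar>"
    using zero by (simp add: sum_subtractf flip: of_int_sum)
  also have "\<dots> \<le> (\<Sum>v\<in>V. \<bar>z v - of_int (s v)\<bar>)" by (rule sum_abs)
  also have "\<dots> < (\<Sum>v\<in>V. 1 / card V)"
  proof (intro sum_strict_mono fin ne)
    fix v assume "v \<in> V"
    then show "\<bar>z v - of_int (s v)\<bar> < 1 / card V"
      using near[of v] by (auto simp: s_def abs_if split: if_splits)
  qed
  also have "\<dots> = 1" using fin ne by simp
  finally show False by simp
qed

text \<open>The absolute value of \<open>x\<close> is the geometric mean of \<open>a\<close> and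
  \<open>b\<close>. This carries flatness of two columns over to the products of their
  entries.\<close>

lemma abs_geometric_mean_diff_less:
  fixes x a b \<delta> :: real
  assumes x: "x\<^sup>2 = a * b" and "0 \<le> a" "0 \<le> b" "0 \<le> \<delta>" "\<delta> \<le> 1"
    and a: "\<bar>a - 1\<bar> < \<delta>" and b: "\<bar>b - 1\<bar> < \<delta>"
  shows "\<bar>\<bar>x\<bar> - 1\<bar> < \<delta>"
proof -
  have "a * b < (1 + \<delta>) * (1 + \<delta>)"
    using assms by (intro mult_strict_mono) auto
  then have "\<bar>x\<bar>\<^sup>2 < (1 + \<delta>)\<^sup>2"
    by (simp add: x power2_eq_square[of "1 + \<delta>"])
  then have "\<bar>x\<bar> < 1 + \<delta>"
    by (rule power2_less_imp_less) (use \<open>0 \<le> \<delta>\<close> in simp)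
  moreover have "(1 - \<delta>) * (1 - \<delta>) < a * b"
    using assms by (intro mult_strict_mono) auto
  \<comment> \<open>The bound \<open>\<delta> \<le> 1\<close> keeps \<open>1 - \<delta>\<close>
    nonnegative, so the lower bounds may be multiplied.\<close>
  then have "(1 - \<delta>)\<^sup>2 < \<bar>x\<bar>\<^sup>2"
    by (simp add: x power2_eq_square[of "1 - \<delta>"])
  then have "1 - \<delta> < \<bar>x\<bar>"
    by (rule power2_less_imp_less) simp
  ultimately show ?thesis by auto
qed

text \<open>Phrased for a general real symmetric matrix with a 2-colouring \<open>c\<close>, so that
  every choice of edge weights is covered at once.\<close>

theorem bipartite_odd_not_eps_uniform_mixing:
  assumes fin: "finite V" and odd: "odd (card V)"
    and real: "\<And>x y. x \<in> V \<Longrightarrow> y \<in> V \<Longrightarrow> A x y \<in> \<real>"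
    and sym: "\<And>x y. x \<in> V \<Longrightarrow> y \<in> V \<Longrightarrow> A x y = A y x"
    and bip: "\<And>x y. x \<in> V \<Longrightarrow> y \<in> V \<Longrightarrow> A x y \<noteq> 0 \<Longrightarrow> c x \<noteq> (c y :: bool)"
    and ab: "a \<in> V" "b \<in> V" "a \<noteq> b" "c a = c b"
  shows "\<not> eps_uniform_mixing V A"
proof
  assume mixing: "eps_uniform_mixing V A"
  define N where "N = real (card V)"
  have N: "N \<ge> 1" using odd by (cases "card V") (auto simp: N_def)
  \<comment> \<open>This tolerance becomes 1/N after the scaling by \<open>N\<close> below, the
    error that each of the N terms may have in \<open>odd_sum_near_sign_neq_0\<close>.\<close>
  then have "1 / N\<^sup>2 > 0" by simp
  with mixing obtain t where t: "\<And>u. u \<in> V \<Longrightarrow>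
      L2_set (\<lambda>v. norm (mat_vec_on V (transition_matrix V A t) (char_vec u) v
             * mat_vec_on V (\<lambda>x y. cnj (transition_matrix V A t x y)) (char_vec u) v
             - 1 / of_nat (card V))) V < 1 / N\<^sup>2"
    unfolding eps_uniform_mixing_def by metis
  define M where "M = (\<lambda>u v. \<i> * complex_of_real t * A u v)"
  define U where "U = mat_exp_on V M"
  have col: "mat_vec_on V K (char_vec u) v = K v u" if "u \<in> V" for K u v
    using that fin
    by (simp add: mat_vec_on_def char_vec_def if_distrib[of "\<lambda>c. _ * c"] cong: if_cong)
  \<comment> \<open>A single coordinate is at most the Euclidean norm of the column; the result is
    then scaled by \<open>N\<close>.\<close>
  have flat: "\<bar>N * (cmod (U v u))\<^sup>2 - 1\<bar> < 1 / N" if "u \<in> V" "v \<in> V" for u v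
  proof -
    let ?f = "\<lambda>v. norm (U v u * cnj (U v u) - 1 / of_nat (card V))"
    have "?f v \<le> L2_set ?f V"
      using fin that by (intro member_le_L2_set)
    also have "\<dots> < 1 / N\<^sup>2"
      using t[OF that(1)] by (simp add: col that transition_matrix_def U_def M_def)
    finally have "cmod (of_real ((cmod (U v u))\<^sup>2 - 1 / N)) < 1 / N\<^sup>2"
      by (simp add: N_def complex_norm_square del: of_real_power)
    then have "\<bar>(cmod (U v u))\<^sup>2 - 1 / N\<bar> < 1 / N\<^sup>2"
      by (simp only: norm_of_real)
    then have "N * \<bar>(cmod (U v u))\<^sup>2 - 1 / N\<bar> < N * (1 / N\<^sup>2)"
      using N by (intro mult_strict_left_mono) auto
    moreover have "N * \<bar>(cmod (U v u))\<^sup>2 - 1 / N\<bar> = \<bar>N * (cmod (U v u))\<^sup>2 - 1\<bar>"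
      using N abs_mult[of N "(cmod (U v u))\<^sup>2 - 1 / N"] by (simp add: right_diff_distrib)
    ultimately show ?thesis using N by (simp add: power2_eq_square)
  qed
  have M_cnj: "cnj (M x y) = - M x y" if "x \<in> V" "y \<in> V" for x y
    using real[OF that] by (auto simp: M_def elim!: Reals_cases)
  \<comment> \<open>The conjugate of U(t) is U(-t). As \<open>M_cnj\<close> is available on
    \<open>V\<close> only, the powers are compared by induction instead of by rewriting the
    matrix.\<close>
  have U_cnj: "cnj (U x y) = mat_exp_on V (\<lambda>x y. - M x y) x y" if xy: "x \<in> V" "y \<in> V" for x y
  proof -
    have "mat_pow_on V (\<lambda>x y. cnj (M x y)) k u y = mat_pow_on V (\<lambda>x y. - M x y) k u y"
      if "u \<in> V" for k u
      using that by (induction k arbitrary: u) (auto intro!: sum.cong simp: M_cnj)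
    then show ?thesis
      unfolding U_def by (simp add: cnj_mat_exp_on fin xy) (simp add: mat_exp_on_def xy)
  qed
  have U_sign: "cnj (U x y) = (if c x = c y then 1 else -1) * U x y"
    if "x \<in> V" "y \<in> V" for x y
    unfolding U_cnj[OF that] unfolding U_def
    by (rule mat_exp_on_uminus_bipartite[OF fin that]) (use bip in \<open>auto simp: M_def\<close>)
  \<comment> \<open>The terms of the inner product of columns \<open>a\<close> and
    \<open>b\<close>.\<close>
  define z where "z v = cnj (U v a) * U v b" for v
  have "(\<Sum>v\<in>V. z v) = (\<Sum>v\<in>V. mat_exp_on V (\<lambda>x y. - M x y) a v * mat_exp_on V M v b)"
  proof (rule sum.cong[OF refl])
    fix v assume v: "v \<in> V"
    have "cnj (U v a) = mat_exp_on V (\<lambda>x y. - M x y) a v"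
      unfolding U_cnj[OF v ab(1)]
      \<comment> \<open>Symmetry turns the conjugated column \<open>a\<close> into row
        \<open>a\<close> of exp(-M), so the sum is the entry at \<open>(a, b)\<close> of the
        identity matrix.\<close>
      by (rule mat_exp_on_sym[OF fin v ab(1)]) (use sym in \<open>simp add: M_def\<close>)
    then show "z v = mat_exp_on V (\<lambda>x y. - M x y) a v * mat_exp_on V M v b"
      by (simp add: z_def U_def)
  qed
  also have "\<dots> = 0"
    using mat_exp_on_uminus_mult[OF fin ab(1,2), of M] ab(3) by simp
  finally have "(\<Sum>v\<in>V. N * Re (z v)) = 0"
    by (metis Re_sum mult_zero_right sum_distrib_left zero_complex.simps(1))
  moreover have "(\<Sum>v\<in>V. N * Re (z v)) \<noteq> 0"
  proof (rule odd_sum_near_sign_neq_0[OF fin odd])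
    fix v assume v: "v \<in> V"
    \<comment> \<open>Since \<open>a\<close> and \<open>b\<close> have the same colour, conjugation
      multiplies \<open>U v a\<close> and \<open>U v b\<close> by the same sign.\<close>
    have "cnj (z v) = z v"
      using U_sign[OF v ab(1)] U_sign[OF v ab(2)] ab(4) by (simp add: z_def)
    then have "z v \<in> \<real>" by (simp add: Reals_cnj_iff)
    then have "\<bar>Re (z v)\<bar> = cmod (U v a) * cmod (U v b)"
      using in_Reals_norm[of "z v"] by (simp add: z_def norm_mult)
    then have "(Re (z v))\<^sup>2 = (cmod (U v a))\<^sup>2 * (cmod (U v b))\<^sup>2"
      by (metis power2_abs power_mult_distrib)
    then have "(N * Re (z v))\<^sup>2 = (N * (cmod (U v a))\<^sup>2) * (N * (cmod (U v b))\<^sup>2)"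
      by (simp add: power_mult_distrib) (simp add: power2_eq_square)
    then show "\<bar>\<bar>N * Re (z v)\<bar> - 1\<bar> < 1 / card V"
      unfolding N_def[symmetric]
      by (rule abs_geometric_mean_diff_less) (use N flat ab v in auto)
  qed
  ultimately show False by simp
qed

theorem theorem17:
  fixes V :: "'a set" and E :: "'a set set"
    and w\<^sub>T :: "'a set \<Rightarrow> real" and w\<^sub>S :: "('a + 'a set) set \<Rightarrow> real"
  assumes "graph_tree V E" and "weighted_graph V E w\<^sub>T"
    and "2 \<le> card V"
    and "weighted_graph (subdiv_verts V E) (subdiv_edges E) w\<^sub>S"
  shows "\<not> eps_uniform_mixing (subdiv_verts V E) (adjacency_matrix (subdiv_edges E) w\<^sub>S)"
proof -
  \<comment> \<open>Two old vertices are available because the tree has at least two; on a single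
    vertex the walk is trivially uniform.\<close>
  obtain a b where ab: "a \<in> V" "b \<in> V" "a \<noteq> b"
    using assms(3) by (metis card_le_Suc0_iff_eq card.infinite not_less_eq_eq numeral_2_eq_2 zero_le)
  show ?thesis
  \<comment> \<open>Every edge of the subdivision joins an old vertex to a new one, so
    \<open>isl\<close> is a proper 2-colouring and the two old vertices share a class.\<close>
  proof (rule bipartite_odd_not_eps_uniform_mixing[where c = isl and a = "Inl a" and b = "Inl b"])
    show "finite (subdiv_verts V E)"
      using assms(4) by (simp add: weighted_graph_def simple_graph_def)
    show "odd (card (subdiv_verts V E))"
      using assms(1) by (rule odd_card_subdiv_verts)
  qed (use ab in \<open>auto simp: adjacency_matrix_def insert_commute subdiv_verts_def
      subdiv_edges_def doubleton_eq_iff\<close>)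
qed

end
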